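(* Let $t\in\mathbb{R}$, $t\neq 0$. There is exactly one real sequence $(a_n)_{n\geq -1}$ with $a_{-1}=-1$ and $-1<a_n<1$ for all $n\geq 0$ that satisfies the discrete Painlevé II equation \[ a_{n+1}+a_{n-1} = \frac{-2(n+1)a_n}{t(1-a_n^2)}, \qquad n\geq 0. \] This solution is obtained by taking $a_0 = I_1(t)/I_0(t)$.
   Context: $I_n(t)$ denotes the modified Bessel function of the first kind of order $n$; for integer $n\ge 0$, $I_n(t)=\frac{1}{\pi}\int_0^\pi e^{t\cos\theta}\cos(n\theta)\,d\theta$. Given $a_{-1}=-1$ and a value of $a_0$, the equation determines $a_1,a_2,\ldots$ recursively as long as $a_n^2\neq 1$. *)

theory Defs
  imports "HOL-Analysis.Analysis"
begin

definition bessel_I :: "nat \<Rightarrow> real \<Rightarrow> real" where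
  "bessel_I n t = 1 / pi * integral {0..pi} (\<lambda>\<theta>. exp (t * cos \<theta>) * cos (real n * \<theta>))"

text \<open>A sequence indexed by the integers \<open>n \<ge> -1\<close> is an extensional function on \<open>{-1..}\<close>, so
  that equality of functions is equality of sequences. The condition \<open>(a n)\<^sup>2 \<noteq> 1\<close> says that the
  right-hand side of the equation is defined; it keeps the convention \<open>x / 0 = 0\<close> from producing
  spurious solutions.\<close>

definition dPII :: "real \<Rightarrow> (int \<Rightarrow> real) \<Rightarrow> bool" where
  "dPII t a \<longleftrightarrow>
     (\<forall>n\<ge>0. (a n)\<^sup>2 \<noteq> 1 \<and>
        a (n + 1) + a (n - 1) = (- 2 * (real_of_int n + 1) * a n) / (t * (1 - (a n)\<^sup>2)))"

end

(* Write m(k) = I_k(t) / I_0(t) for the trigonometric moments of the weight exp (t cos x). Integration by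
   parts gives k m(k) = (t/2) (m(k-1) - m(k+1)), and for any even sequence m with m(0) = 1 and this
   recurrence the Verblunsky coefficients a_n of the monic polynomials orthogonal for the Toeplitz form of m
   satisfy dPII, with a_0 = m(1), as long as a_n^2 is not 1.
   If a_0 = I_1(t) / I_0(t), the Toeplitz form is positive definite, and the squared norms
   prod_{k<n} (1 - a_k^2) of the polynomials are positive, so |a_n| < 1.
   Conversely, let a be a solution in (-1,1), and let m be the sequence given by the moment recurrence with
   m(0) = 1 and m(1) = a_0. Then a consists of the Verblunsky coefficients of m, the form of m is positive
   semidefinite, and |m(k)| <= 1. The recurrence has only one bounded solution with m(0) = 1, so
   m(1) = I_1(t) / I_0(t). *)
theory Submission
  imports Defs "HOL-Computational_Algebra.Polynomial"
begin

section \<open>Toeplitz forms on polynomials\<close>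

text \<open>The pairing \<open>\<langle>p, z\<^sup>j\<rangle>\<close> for the form with \<open>\<langle>z\<^sup>i, z\<^sup>j\<rangle> = m (i - j)\<close>; the exponent \<open>j\<close> may be negative.\<close>

definition toep :: "(int \<Rightarrow> real) \<Rightarrow> int \<Rightarrow> real poly \<Rightarrow> real" where
  "toep m j p = (\<Sum>i\<le>degree p. coeff p i * m (int i - j))"

lemma toep_eq_sum: "degree p \<le> N \<Longrightarrow> toep m j p = (\<Sum>i\<le>N. coeff p i * m (int i - j))"
  unfolding toep_def by (rule sum.mono_neutral_left) (auto simp: coeff_eq_0)

lemma toep_1: "toep m j 1 = m (- j)"
  by (simp add: toep_def)

lemma toep_monom: "toep m j (monom c k) = c * m (int k - j)"
  by (subst toep_eq_sum[of _ k])
     (simp_all add: degree_monom_le if_distrib[of "\<lambda>x. x * _"] sum.delta cong: if_cong)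

lemma toep_add: "toep m j (p + q) = toep m j p + toep m j q"
  by (subst (1 2 3) toep_eq_sum[of _ "max (degree p) (degree q)"])
     (auto simp: degree_add_le sum.distrib algebra_simps)

lemma toep_smult: "toep m j (smult c p) = c * toep m j p"
  by (subst (1 2) toep_eq_sum[of _ "degree p"])
     (auto simp: sum_distrib_left algebra_simps)

lemma toep_diff: "toep m j (p - q) = toep m j p - toep m j q"
  using toep_add[of m j p "smult (-1) q"] toep_smult[of m j "-1" q] by simp

lemma toep_pCons_0: "toep m j (pCons 0 p) = toep m (j - 1) p"
  by (subst toep_eq_sum[of _ "Suc (degree p)"])
     (auto simp: degree_pCons_le sum.atMost_Suc_shift toep_def algebra_simps simp del: sum.atMost_Suc)

definition toep_form :: "(int \<Rightarrow> real) \<Rightarrow> real poly \<Rightarrow> real poly \<Rightarrow> real" where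
  "toep_form m p q = (\<Sum>j\<le>degree q. coeff q j * toep m (int j) p)"

lemma toep_form_eq_sum:
  "degree q \<le> N \<Longrightarrow> toep_form m p q = (\<Sum>j\<le>N. coeff q j * toep m (int j) p)"
  unfolding toep_form_def by (rule sum.mono_neutral_left) (auto simp: coeff_eq_0)

lemma toep_form_double_sum:
  "degree p \<le> M \<Longrightarrow> degree q \<le> N \<Longrightarrow>
    toep_form m p q = (\<Sum>j\<le>N. \<Sum>i\<le>M. coeff q j * coeff p i * m (int i - int j))"
  by (simp add: toep_form_eq_sum[of q N] toep_eq_sum[of p M] sum_distrib_left mult.assoc)

lemma toep_form_add_left: "toep_form m (p + p') q = toep_form m p q + toep_form m p' q"
  by (simp add: toep_form_def toep_add sum.distrib algebra_simps)

lemma toep_form_smult_left: "toep_form m (smult c p) q = c * toep_form m p q"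
  by (simp add: toep_form_def toep_smult sum_distrib_left algebra_simps)

locale even_moments =
  fixes m :: "int \<Rightarrow> real"
  assumes even: "m (- k) = m k"
begin

lemma toep_form_commute:
  "toep_form m p q = toep_form m q p"
proof -
  have "m (int i - int j) = m (int j - int i)" for i j
    using even[of "int i - int j"] by simp
  then show ?thesis
    by (subst (1 2) toep_form_double_sum[OF order_refl order_refl], subst sum.swap)
       (simp add: mult_ac)
qed

lemma toep_form_add_square:
  "toep_form m (smult c p + q) (smult c p + q) =
    c\<^sup>2 * toep_form m p p + 2 * c * toep_form m p q + toep_form m q q"
proof -
  let ?s = "smult c p + q"
  have "toep_form m ?s ?s = c * toep_form m p ?s + toep_form m q ?s"
    by (simp add: toep_form_add_left toep_form_smult_left)
  also have "toep_form m p ?s = c * toep_form m p p + toep_form m q p"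
    by (subst toep_form_commute) (simp add: toep_form_add_left toep_form_smult_left)
  also have "toep_form m q ?s = c * toep_form m p q + toep_form m q q"
    by (subst toep_form_commute) (simp add: toep_form_add_left toep_form_smult_left)
  finally show ?thesis
    using toep_form_commute[of q p] by (simp add: algebra_simps power2_eq_square)
qed

text \<open>Tested on \<open>z^n + 1\<close> and \<open>1 - z^n\<close>, the form takes the values
  \<open>2 * (m 0 + m n)\<close> and \<open>2 * (m 0 - m n)\<close>.\<close>

lemma abs_moment_le:
  assumes psd: "\<And>p. 0 \<le> toep_form m p p"
  shows "\<bar>m k\<bar> \<le> m 0"
proof -
  obtain n where n: "k = int n \<or> k = - int n"
    by (metis int_cases2)
  have "toep_form m p p = c\<^sup>2 * m 0 + 2 * c * m (int n) + m 0"
    if "p = smult c (monom 1 n) + monom 1 0" for p c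
    unfolding that toep_form_add_square
    by (subst toep_form_commute[of "monom 1 n"], subst (1 2 3) toep_form_def)
       (simp add: degree_monom_eq toep_monom toep_1 even if_distrib[of "\<lambda>x. x * _"] sum.delta cong: if_cong)
  from this[of _ 1] this[of _ "-1"] psd[of "smult 1 (monom 1 n) + monom 1 0"]
    psd[of "smult (-1) (monom 1 n) + monom 1 0"] n even
  show ?thesis by auto
qed

end

section \<open>Szego polynomials\<close>

text \<open>The index of the coefficients is shifted by one: \<open>\<alpha> (Suc n)\<close> is \<open>a\<^sub>n\<close>, and \<open>\<alpha> 0\<close> is \<open>a\<^sub>-\<^sub>1\<close>, which the
  polynomials themselves do not use.\<close>

fun szego :: "(nat \<Rightarrow> real) \<Rightarrow> nat \<Rightarrow> real poly" and szego_rev where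
  "szego \<alpha> 0 = 1"
| "szego \<alpha> (Suc n) = pCons 0 (szego \<alpha> n) - smult (\<alpha> (Suc n)) (szego_rev \<alpha> n)"
| "szego_rev \<alpha> 0 = 1"
| "szego_rev \<alpha> (Suc n) = szego_rev \<alpha> n - smult (\<alpha> (Suc n)) (pCons 0 (szego \<alpha> n))"

lemma degree_szego_le: "degree (szego \<alpha> n) \<le> n \<and> degree (szego_rev \<alpha> n) \<le> n"
proof (induction n)
  case (Suc n)
  then show ?case
    by (auto intro!: degree_diff_le order.trans[OF degree_smult_le] order.trans[OF degree_pCons_le])
qed auto

lemma coeff_szego_top: "coeff (szego \<alpha> n) n = 1"
  using degree_szego_le[of \<alpha>] by (induction n) (auto simp: coeff_eq_0 le_imp_less_Suc)

lemma coeff_szego_rev_0: "coeff (szego_rev \<alpha> n) 0 = 1"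
  by (induction n) auto

lemma coeff_szego_0: "coeff (szego \<alpha> (Suc n)) 0 = - \<alpha> (Suc n)"
  by (simp add: coeff_szego_rev_0)

lemma coeff_szego_rev_top: "coeff (szego_rev \<alpha> (Suc n)) (Suc n) = - \<alpha> (Suc n)"
  using degree_szego_le[of \<alpha> n] by (simp add: coeff_szego_top coeff_eq_0 le_imp_less_Suc)

lemma toep_szego_Suc:
  "toep m j (szego \<alpha> (Suc n)) = toep m (j - 1) (szego \<alpha> n) - \<alpha> (Suc n) * toep m j (szego_rev \<alpha> n)"
  "toep m j (szego_rev \<alpha> (Suc n)) = toep m j (szego_rev \<alpha> n) - \<alpha> (Suc n) * toep m (j - 1) (szego \<alpha> n)"
  by (simp_all add: toep_diff toep_smult toep_pCons_0)

text \<open>This is the squared norm of \<open>szego \<alpha> n\<close> once \<open>\<alpha>\<close>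
  consists of the Verblunsky coefficients of the form; see \<open>toep_form_szego\<close>.\<close>

definition szego_norm :: "(nat \<Rightarrow> real) \<Rightarrow> nat \<Rightarrow> real" where
  "szego_norm \<alpha> n = (\<Prod>k<n. 1 - (\<alpha> (Suc k))\<^sup>2)"

text \<open>The reversed polynomial is \<open>z^n P(1/z)\<close>, and for even moments the
  substitution of \<open>1/z\<close> for \<open>z\<close> preserves the pairing.\<close>

lemma (in even_moments) toep_szego_rev:
  "toep m j (szego_rev \<alpha> n) = toep m (int n - j) (szego \<alpha> n)"
proof (induction n arbitrary: j)
  case 0
  then show ?case using even[of j] by (simp add: toep_1)
next
  case (Suc n)
  show ?case
    unfolding toep_szego_Suc Suc by (simp add: algebra_simps)
qed

text \<open>Positivity is left out so that the locale covers both the Bessel moments and the formal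
  moments generated from an arbitrary \<open>m 1\<close>.\<close>

locale bessel_moments = even_moments +
  fixes t :: real
  assumes m0: "m 0 = 1"
    and pearson: "of_int k * m k = t / 2 * (m (k - 1) - m (k + 1))"
begin

text \<open>Both \<open>z P\<close> and the reversed polynomial are orthogonal to
  \<open>z, ..., z^n\<close>, where \<open>P\<close> has degree \<open>n\<close>. Assumption
  \<open>verb\<close> is exactly the choice of \<open>\<alpha> (Suc n)\<close> that makes their
  combination orthogonal to 1 as well.\<close>

lemma szego_orthogonal:
  assumes verb: "\<And>k. k < n \<Longrightarrow> toep m (-1) (szego \<alpha> k) = \<alpha> (Suc k) * szego_norm \<alpha> k"
  shows "(\<forall>j. 0 \<le> j \<and> j < int n \<longrightarrow> toep m j (szego \<alpha> n) = 0) \<and>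
    toep m (int n) (szego \<alpha> n) = szego_norm \<alpha> n"
  using verb
proof (induction n)
  case 0
  then show ?case by (simp add: toep_1 m0 szego_norm_def)
next
  case (Suc n)
  have IH: "\<And>j. 0 \<le> j \<Longrightarrow> j < int n \<Longrightarrow> toep m j (szego \<alpha> n) = 0"
    "toep m (int n) (szego \<alpha> n) = szego_norm \<alpha> n"
    using Suc.IH Suc.prems by auto
  have v: "toep m (-1) (szego \<alpha> n) = \<alpha> (Suc n) * szego_norm \<alpha> n"
    using Suc.prems by simp
  have "toep m j (szego \<alpha> (Suc n)) = 0" if "0 \<le> j" "j < int (Suc n)" for j
    using that IH v by (cases "j = 0") (simp_all add: toep_szego_Suc toep_szego_rev del: szego.simps)
  moreover have "toep m (int (Suc n)) (szego \<alpha> (Suc n)) = szego_norm \<alpha> (Suc n)"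
    using IH v by (simp add: toep_szego_Suc toep_szego_rev szego_norm_def power2_eq_square algebra_simps del: szego.simps)
  ultimately show ?case by blast
qed

text \<open>The operator \<open>z d/dz\<close> multiplies the coefficient of \<open>z^i\<close> by
  \<open>i = j + (i - j)\<close>, and \<open>pearson\<close> rewrites the part with
  \<open>i - j\<close>.\<close>

lemma toep_euler:
  "toep m j (pCons 0 (pderiv p)) =
    of_int j * toep m j p + t / 2 * (toep m (j + 1) p - toep m (j - 1) p)"
proof -
  have "coeff (pCons 0 (pderiv p)) i * m (int i - j) = of_int j * (coeff p i * m (int i - j)) +
      t / 2 * (coeff p i * m (int i - (j + 1)) - coeff p i * m (int i - (j - 1)))" for i
  proof -
    have "coeff (pCons 0 (pderiv p)) i = of_nat i * coeff p i"
      by (cases i) (auto simp: coeff_pderiv)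
    then show ?thesis
      using arg_cong[OF pearson[of "int i - j"], of "\<lambda>x. coeff p i * x"] by (simp add: algebra_simps)
  qed
  moreover have "degree (pCons 0 (pderiv p)) \<le> degree p"
    by (intro degree_le allI impI) (auto simp: coeff_pCons coeff_pderiv coeff_eq_0 split: nat.splits)
  ultimately show ?thesis
    by (subst (1 2 3 4) toep_eq_sum[of _ "degree p"])
       (simp_all add: sum.distrib sum_divide_distrib[symmetric] sum_distrib_left[symmetric] sum_subtractf)
qed

text \<open>Both sides come from evaluating \<open>\<langle>z P' - (n + 1) P, Q\<rangle>\<close> in two ways, where \<open>P\<close> is the polynomial of degree
  \<open>n + 1\<close> and \<open>Q\<close> the reversed polynomial of degree \<open>n\<close>: \<open>Q\<close> is orthogonal to \<open>z, \<dots>, z\<^sup>n\<close>, and by the moment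
  recurrence \<open>z P' - (n + 1) P\<close> is orthogonal to \<open>z, \<dots>, z\<^sup>n\<^sup>-\<^sup>1\<close>.\<close>

lemma verblunsky_step:
  assumes verb: "\<And>k. k \<le> n \<Longrightarrow> toep m (-1) (szego \<alpha> k) = \<alpha> (Suc k) * szego_norm \<alpha> k"
    and \<alpha>0: "\<alpha> 0 = -1"
  shows "t / 2 * (toep m (-1) (szego \<alpha> (Suc n)) + \<alpha> n * szego_norm \<alpha> (Suc n)) =
    - (real n + 1) * \<alpha> (Suc n) * szego_norm \<alpha> n"
proof -
  let ?P = "szego \<alpha> (Suc n)" and ?Q = "szego_rev \<alpha> n"
  define R where "R = pCons 0 (pderiv ?P) - smult (real n + 1) ?P"
  have orthP: "toep m j ?P = 0" if "0 \<le> j" "j \<le> int n" for j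
    using szego_orthogonal[of "Suc n" \<alpha>] verb that by auto
  have normP: "toep m (int n + 1) ?P = szego_norm \<alpha> (Suc n)"
    using szego_orthogonal[of "Suc n" \<alpha>] verb by (auto simp: add.commute)
  have orthQ: "toep m j ?Q = (if j = 0 then szego_norm \<alpha> n else 0)" if "0 \<le> j" "j \<le> int n" for j
    using szego_orthogonal[of n \<alpha>] verb that by (auto simp: toep_szego_rev)
  have coeffR: "coeff R i = (real i - real n - 1) * coeff ?P i" for i
    unfolding R_def by (cases i) (auto simp: coeff_pderiv algebra_simps simp del: szego.simps)
  have degR: "degree R \<le> n"
  proof (rule degree_le, intro allI impI)
    fix i assume "n < i"
    then show "coeff R i = 0"
      using degree_szego_le[of \<alpha> "Suc n"] unfolding coeffR
      by (cases "i = Suc n") (auto simp: coeff_eq_0 simp del: szego.simps)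
  qed
  have toepR: "toep m j R = t / 2 * (toep m (j + 1) ?P - toep m (j - 1) ?P)" if "0 \<le> j" "j \<le> int n" for j
    using orthP[OF that] unfolding R_def toep_diff toep_smult toep_euler by simp
  have "toep_form m ?Q R = (\<Sum>j\<le>n. if j = 0 then coeff R j * szego_norm \<alpha> n else 0)"
    unfolding toep_form_eq_sum[OF degR] by (rule sum.cong) (auto simp: orthQ)
  also have "\<dots> = (real n + 1) * \<alpha> (Suc n) * szego_norm \<alpha> n"
    by (simp add: sum.delta coeffR coeff_szego_0 algebra_simps del: szego.simps)
  finally have 1: "toep_form m R ?Q = (real n + 1) * \<alpha> (Suc n) * szego_norm \<alpha> n"
    using toep_form_commute by metis
  have 2: "toep_form m R ?Q = (\<Sum>j\<le>n. coeff ?Q j * toep m (int j) R)"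
    by (rule toep_form_eq_sum) (use degree_szego_le in blast)
  show ?thesis
  \<comment> \<open>Only the terms \<open>j = 0\<close> and \<open>j = n\<close> survive. For
    \<open>n = 0\<close> they coincide, and the leading coefficient 1 of \<open>?Q\<close> is
    \<open>- \<alpha> 0\<close>: this is where the initial value -1 enters.\<close>
  proof (cases n)
    case 0
    then show ?thesis
      using 1 2 toepR[of 0] normP \<alpha>0 by (simp add: algebra_simps del: szego.simps)
  next
    case (Suc l)
    have "coeff ?Q j * toep m (int j) R = (if j = 0 then - t / 2 * toep m (-1) ?P
       else if j = n then - \<alpha> n * (t / 2 * szego_norm \<alpha> (Suc n)) else 0)" if "j \<le> n" for j
    proof -
      have "toep m (int j) R = (if j = 0 then - t / 2 * toep m (-1) ?P
         else if j = n then t / 2 * szego_norm \<alpha> (Suc n) else 0)"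
        using toepR[of "int j"] that Suc normP orthP[of "int j + 1"] orthP[of "int j - 1"]
        by (auto simp del: szego.simps)
      then show ?thesis
        using Suc by (auto simp: coeff_szego_rev_0 coeff_szego_rev_top simp del: szego.simps szego_rev.simps)
    qed
    then have "toep_form m R ?Q = (\<Sum>j\<le>n. if j = 0 then - t / 2 * toep m (-1) ?P
       else if j = n then - \<alpha> n * (t / 2 * szego_norm \<alpha> (Suc n)) else 0)"
      unfolding 2 by (intro sum.cong) auto
    also have "\<dots> = - t / 2 * toep m (-1) ?P - \<alpha> n * (t / 2 * szego_norm \<alpha> (Suc n))"
      unfolding Suc by (subst sum.atMost_Suc_shift) (simp add: sum.delta del: szego.simps)
    finally show ?thesis
      using 1 by (simp add: algebra_simps)
  qed
qed

lemma toep_form_szego: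
  assumes verb: "\<And>k. k < n \<Longrightarrow> toep m (-1) (szego \<alpha> k) = \<alpha> (Suc k) * szego_norm \<alpha> k"
    and deg: "degree q \<le> n"
  shows "toep_form m (szego \<alpha> n) q = coeff q n * szego_norm \<alpha> n"
proof -
  have "toep_form m (szego \<alpha> n) q = (\<Sum>j\<le>n. if j = n then coeff q j * szego_norm \<alpha> n else 0)"
    unfolding toep_form_eq_sum[OF deg]
    using szego_orthogonal[of n \<alpha>] verb by (intro sum.cong) auto
  then show ?thesis by simp
qed

text \<open>The Szego polynomials are an orthogonal basis. Splitting off the leading multiple of
  \<open>szego \<alpha> n\<close> writes the form as a sum of squares weighted by
  \<open>szego_norm\<close>.\<close>

lemma toep_form_nonneg:
  assumes verb: "\<And>k. toep m (-1) (szego \<alpha> k) = \<alpha> (Suc k) * szego_norm \<alpha> k"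
    and nonneg: "\<And>n. 0 \<le> szego_norm \<alpha> n"
  shows "0 \<le> toep_form m p p"
proof -
  have "0 \<le> toep_form m p p" if "\<forall>i\<ge>n. coeff p i = 0" for n p
    using that
  proof (induction n arbitrary: p)
    case 0
    then have "p = 0" by (intro poly_eqI) auto
    then show ?case by (simp add: toep_form_def)
  next
    case (Suc n)
    let ?S = "szego \<alpha> n"
    define r where "r = p - smult (coeff p n) ?S"
    have r: "\<forall>i\<ge>n. coeff r i = 0"
    proof (intro allI impI)
      fix i assume "n \<le> i"
      then show "coeff r i = 0"
        using Suc.prems degree_szego_le[of \<alpha> n] unfolding r_def
        by (cases "i = n") (auto simp: coeff_szego_top coeff_eq_0)
    qed
    then have "degree r \<le> n" by (intro degree_le) auto
    then have "toep_form m ?S r = 0"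
      using toep_form_szego[of n \<alpha> r] verb r by simp
    moreover have "toep_form m ?S ?S = szego_norm \<alpha> n"
      using toep_form_szego[of n \<alpha> ?S] verb degree_szego_le[of \<alpha> n]
      by (simp add: coeff_szego_top)
    moreover have "p = smult (coeff p n) ?S + r"
      by (simp add: r_def)
    ultimately have "toep_form m p p = (coeff p n)\<^sup>2 * szego_norm \<alpha> n + toep_form m r r"
      using toep_form_add_square[of "coeff p n" ?S r] by simp
    then show ?case
      using Suc.IH[OF r] nonneg[of n] by simp
  qed
  from this[of "Suc (degree p)" p] show ?thesis
    by (simp add: coeff_eq_0)
qed

text \<open>Multiplied by the squared norm, the recurrence has the same right-hand side as
  \<open>verblunsky_step\<close>, so both determine the same next coefficient. Asking for
  \<open>nonsing\<close> only below \<open>n\<close> allows use inside the induction of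
  \<open>verblunsky_less_1\<close>.\<close>

lemma verblunsky_if_recurrence:
  assumes t: "t \<noteq> 0" and \<alpha>0: "\<alpha> 0 = -1" and \<alpha>1: "\<alpha> 1 = m 1"
    and rec: "\<And>n. \<alpha> (Suc (Suc n)) + \<alpha> n =
      - 2 * (real n + 1) * \<alpha> (Suc n) / (t * (1 - (\<alpha> (Suc n))\<^sup>2))"
    and nonsing: "\<And>k. k < n \<Longrightarrow> (\<alpha> (Suc k))\<^sup>2 \<noteq> 1"
  shows "toep m (-1) (szego \<alpha> n) = \<alpha> (Suc n) * szego_norm \<alpha> n"
  using nonsing
proof (induction n rule: less_induct)
  case (less n)
  show ?case
  proof (cases n)
    case 0
    then show ?thesis using \<alpha>1 by (simp add: toep_1 szego_norm_def)
  next
    case (Suc l)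
    define d where "d = 1 - (\<alpha> (Suc l))\<^sup>2"
    have d: "d \<noteq> 0" using less.prems Suc by (simp add: d_def)
    have norm: "szego_norm \<alpha> (Suc l) = szego_norm \<alpha> l * d"
      by (simp add: szego_norm_def d_def)
    have "t / 2 * (toep m (-1) (szego \<alpha> (Suc l)) + \<alpha> l * (szego_norm \<alpha> l * d)) =
        - (real l + 1) * \<alpha> (Suc l) * szego_norm \<alpha> l"
      unfolding norm[symmetric]
      by (rule verblunsky_step) (use less Suc \<alpha>0 in auto)
    moreover have "t / 2 * ((\<alpha> (Suc (Suc l)) + \<alpha> l) * (szego_norm \<alpha> l * d)) =
        - (real l + 1) * \<alpha> (Suc l) * szego_norm \<alpha> l"
      using t d unfolding rec d_def[symmetric] by (simp add: field_simps)
    ultimately have "t / 2 * toep m (-1) (szego \<alpha> (Suc l)) =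
        t / 2 * (\<alpha> (Suc (Suc l)) * (szego_norm \<alpha> l * d))"
      unfolding distrib_left distrib_right by linarith
    then show ?thesis
      using t by (simp add: Suc norm del: szego.simps)
  qed
qed

text \<open>The squared norm of the polynomial of degree \<open>n + 1\<close> is positive, and it is
  the previous one, positive by induction, times
  \<open>1 - (\<alpha> (Suc n))\<^sup>2\<close>.\<close>

lemma verblunsky_less_1:
  assumes t: "t \<noteq> 0" and \<alpha>0: "\<alpha> 0 = -1" and \<alpha>1: "\<alpha> 1 = m 1"
    and rec: "\<And>n. \<alpha> (Suc (Suc n)) + \<alpha> n =
      - 2 * (real n + 1) * \<alpha> (Suc n) / (t * (1 - (\<alpha> (Suc n))\<^sup>2))"
    and pos: "\<And>p. p \<noteq> 0 \<Longrightarrow> 0 < toep_form m p p"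
  shows "(\<alpha> (Suc n))\<^sup>2 < 1"
proof (induction n rule: less_induct)
  case (less n)
  let ?P = "szego \<alpha> (Suc n)"
  have "toep m (-1) (szego \<alpha> k) = \<alpha> (Suc k) * szego_norm \<alpha> k" if "k < Suc n" for k
  proof (rule verblunsky_if_recurrence[OF t \<alpha>0 \<alpha>1 rec])
    fix i assume "i < k"
    then show "(\<alpha> (Suc i))\<^sup>2 \<noteq> 1"
      using less[of i] that by simp
  qed
  then have "toep_form m ?P ?P = szego_norm \<alpha> (Suc n)"
    using toep_form_szego[of "Suc n" \<alpha> ?P] degree_szego_le[of \<alpha> "Suc n"] coeff_szego_top[of \<alpha> "Suc n"]
    by (simp del: szego.simps)
  moreover have "?P \<noteq> 0"
    using coeff_szego_top[of \<alpha> "Suc n"] by (metis coeff_0 zero_neq_one)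
  ultimately have "0 < szego_norm \<alpha> n * (1 - (\<alpha> (Suc n))\<^sup>2)"
    using pos[of ?P] by (simp add: szego_norm_def)
  moreover have "0 < szego_norm \<alpha> n"
    unfolding szego_norm_def by (rule prod_pos) (use less in auto)
  ultimately show ?case
    by (simp add: zero_less_mult_iff)
qed

lemma abs_moment_le_1:
  assumes t: "t \<noteq> 0" and \<alpha>0: "\<alpha> 0 = -1" and \<alpha>1: "\<alpha> 1 = m 1"
    and rec: "\<And>n. \<alpha> (Suc (Suc n)) + \<alpha> n =
      - 2 * (real n + 1) * \<alpha> (Suc n) / (t * (1 - (\<alpha> (Suc n))\<^sup>2))"
    and less_1: "\<And>n. (\<alpha> (Suc n))\<^sup>2 < 1"
  shows "\<bar>m k\<bar> \<le> 1"
proof -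
  have "0 \<le> szego_norm \<alpha> n" for n
    unfolding szego_norm_def by (rule prod_nonneg) (use less_1 less_imp_le in auto)
  moreover have "toep m (-1) (szego \<alpha> n) = \<alpha> (Suc n) * szego_norm \<alpha> n" for n
    by (rule verblunsky_if_recurrence[OF t \<alpha>0 \<alpha>1 rec]) (metis less_1 less_irrefl)
  ultimately show ?thesis
    using abs_moment_le[of k] toep_form_nonneg[of \<alpha>] m0 by simp
qed

end

section \<open>Bounded solutions of the moment recurrence\<close>

text \<open>The difference \<open>d\<close> of two solutions has \<open>d 0 = 0\<close>, hence \<open>- t d\<^sub>k d\<^sub>k\<^sub>+\<^sub>1 \<ge> 0\<close>: the terms of the recurrence
  reinforce each other, and \<open>d\<close> is unbounded unless \<open>d 1 = 0\<close>.\<close>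

lemma bounded_bessel_moments_unique:
  assumes "bessel_moments m t" "bessel_moments m' t" and t: "t \<noteq> 0"
    and bdd: "\<And>k. \<bar>m k\<bar> \<le> 1" "\<And>k. \<bar>m' k\<bar> \<le> 1"
  shows "m 1 = m' 1"
proof (rule ccontr)
  assume ne: "m 1 \<noteq> m' 1"
  interpret A: bessel_moments m t by fact
  interpret B: bessel_moments m' t by fact
  define d where "d k = m (int k) - m' (int k)" for k
  define s where "s k = - (d k * d (Suc k)) * t" for k
  have rec: "d (Suc (Suc k)) * t = d k * t - 2 * (real k + 1) * d (Suc k)" for k
    using A.pearson[of "int k + 1"] B.pearson[of "int k + 1"]
    by (simp add: d_def algebra_simps)
  have s_Suc: "s (Suc k) = s k + 2 * (real k + 1) * (d (Suc k))\<^sup>2" for k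
  proof -
    have "s (Suc k) = - d (Suc k) * (d (Suc (Suc k)) * t)"
      by (simp add: s_def)
    then show ?thesis
      unfolding rec by (simp add: s_def algebra_simps power2_eq_square)
  qed
  have "0 \<le> s k" for k
  proof (induction k)
    case 0
    then show ?case by (simp add: s_def d_def A.m0 B.m0)
  qed (simp add: s_Suc)
  have sq: "(d (Suc (Suc k)))\<^sup>2 * t\<^sup>2 \<ge> (d k)\<^sup>2 * t\<^sup>2 + 4 * (real k + 1)\<^sup>2 * (d (Suc k))\<^sup>2" for k
  proof -
    have "(d (Suc (Suc k)))\<^sup>2 * t\<^sup>2 = (d k * t - 2 * (real k + 1) * d (Suc k))\<^sup>2"
      using rec[of k] by (metis power_mult_distrib)
    also have "\<dots> = (d k)\<^sup>2 * t\<^sup>2 + 4 * (real k + 1)\<^sup>2 * (d (Suc k))\<^sup>2 + 4 * (real k + 1) * s k"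
      by (simp add: s_def algebra_simps power2_eq_square)
    finally show ?thesis using \<open>0 \<le> s k\<close> by simp
  qed
  \<comment> \<open>Dropping the middle term of \<open>sq\<close> shows that the odd entries do not
    shrink, so the factor \<open>4 * (k + 1)\<^sup>2\<close> forces growth of the even ones.\<close>
  have odd: "(d 1)\<^sup>2 \<le> (d (Suc (2 * j)))\<^sup>2" for j
  proof (induction j)
    case (Suc j)
    have "(d (Suc (2 * j)))\<^sup>2 * t\<^sup>2 \<le> (d (Suc (2 * Suc j)))\<^sup>2 * t\<^sup>2"
      using order_trans[OF _ sq[of "Suc (2 * j)"], of "(d (Suc (2 * j)))\<^sup>2 * t\<^sup>2"] by simp
    then show ?case using Suc t by simp
  qed simp
  have "\<bar>d k\<bar> \<le> 2" for k
    using bdd(1)[of "int k"] bdd(2)[of "int k"] by (simp add: d_def)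
  then have bd: "(d k)\<^sup>2 \<le> 4" for k
    using power_mono[of "\<bar>d k\<bar>" 2 2] by simp
  have "d 1 \<noteq> 0" using ne by (simp add: d_def)
  \<comment> \<open>With this \<open>j\<close>, \<open>sq\<close> at \<open>2 * j\<close> pushes the
    next even entry beyond the bound 4 on \<open>(d k)\<^sup>2\<close>.\<close>
  then obtain j :: nat where j: "t\<^sup>2 / (d 1)\<^sup>2 < real j"
    using reals_Archimedean2 by blast
  have "t\<^sup>2 < real j * (d 1)\<^sup>2"
    using j \<open>d 1 \<noteq> 0\<close> by (simp add: field_simps)
  also have "\<dots> \<le> (real (2 * j) + 1)\<^sup>2 * (d (Suc (2 * j)))\<^sup>2"
    using odd[of j] by (intro mult_mono) (auto simp: power2_eq_square algebra_simps)
  finally have "4 * t\<^sup>2 < 4 * (real (2 * j) + 1)\<^sup>2 * (d (Suc (2 * j)))\<^sup>2"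
    by simp
  also have "\<dots> \<le> (d (2 * j))\<^sup>2 * t\<^sup>2 + \<dots>"
    by simp
  also have "\<dots> \<le> (d (Suc (Suc (2 * j))))\<^sup>2 * t\<^sup>2"
    by (rule sq)
  also have "\<dots> \<le> 4 * t\<^sup>2"
    using bd by (intro mult_right_mono) auto
  finally show False by simp
qed

text \<open>This is \<open>pearson\<close> solved for the next moment, with the first moment
  \<open>c\<close> left free.\<close>

fun recurrence_moment :: "real \<Rightarrow> real \<Rightarrow> nat \<Rightarrow> real" where
  "recurrence_moment t c 0 = 1"
| "recurrence_moment t c (Suc 0) = c"
| "recurrence_moment t c (Suc (Suc k)) =
    recurrence_moment t c k - 2 * (real k + 1) / t * recurrence_moment t c (Suc k)"

lemma bessel_moments_recurrence_moment:
  assumes "t \<noteq> 0"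
  shows "bessel_moments (\<lambda>k. recurrence_moment t c (nat \<bar>k\<bar>)) t"
proof
  fix k :: int
  define f where "f k = recurrence_moment t c (nat \<bar>k\<bar>)" for k
  have even: "f (- k) = f k" for k by (simp add: f_def)
  have pos: "of_int (int n) * f (int n) = t / 2 * (f (int n - 1) - f (int n + 1))" for n
  proof (cases n)
    case 0
    then show ?thesis by (simp add: f_def)
  next
    case (Suc l)
    then have "nat \<bar>int n\<bar> = Suc l" "nat \<bar>int n + 1\<bar> = Suc (Suc l)" "nat \<bar>int n - 1\<bar> = l" by simp_all
    then show ?thesis using assms by (simp add: f_def Suc right_diff_distrib)
  qed
  \<comment> \<open>Reflecting \<open>k\<close> swaps the two neighbours and changes the sign of
    both sides.\<close>
  have "of_int k * f k = t / 2 * (f (k - 1) - f (k + 1))"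
  proof (cases k rule: int_cases2)
    case (nonneg n)
    then show ?thesis using pos[of n] by simp
  next
    case (nonpos n)
    then have "f k = f (int n)" "f (k - 1) = f (int n + 1)" "f (k + 1) = f (int n - 1)"
      using even[of "int n + 1"] even[of "int n - 1"] by (simp_all add: even)
    then show ?thesis using pos[of n] nonpos by (simp add: algebra_simps)
  qed
  then show "of_int k * recurrence_moment t c (nat \<bar>k\<bar>) =
      t / 2 * (recurrence_moment t c (nat \<bar>k - 1\<bar>) - recurrence_moment t c (nat \<bar>k + 1\<bar>))"
    by (simp only: f_def)
qed auto

section \<open>Moments of the Bessel weight\<close>

definition weight_moment :: "real \<Rightarrow> int \<Rightarrow> real" where
  "weight_moment t k = integral {0..pi} (\<lambda>x. exp (t * cos x) * cos (of_int k * x))"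

lemma bessel_I_eq_weight_moment: "bessel_I n t = weight_moment t (int n) / pi"
  by (simp add: bessel_I_def weight_moment_def)

lemma weight_moment_integrable: "(\<lambda>x. exp (t * cos x) * cos (of_int k * x)) integrable_on {0..pi}"
  by (intro integrable_continuous_interval continuous_intros)

text \<open>The function \<open>exp (t cos x) sin (k x)\<close> vanishes at 0 and \<open>pi\<close>,
  so its derivative integrates to 0.\<close>

lemma weight_moment_pearson:
  "of_int k * weight_moment t k = t / 2 * (weight_moment t (k - 1) - weight_moment t (k + 1))"
proof -
  let ?g = "\<lambda>k x. exp (t * cos x) * cos (of_int k * x)"
  let ?f = "\<lambda>x. of_int k * ?g k x - t / 2 * (?g (k - 1) x - ?g (k + 1) x)"
  have "((\<lambda>x. exp (t * cos x) * sin (of_int k * x)) has_vector_derivative ?f x) (at x within {0..pi})" for x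
  proof -
    have "cos (of_int (k - 1) * x) - cos (of_int (k + 1) * x) = 2 * (sin x * sin (of_int k * x))"
      by (simp add: algebra_simps cos_diff cos_add)
    then have "?f x = exp (t * cos x) * (t * - sin x) * sin (of_int k * x) +
        exp (t * cos x) * (cos (of_int k * x) * of_int k)"
      by (simp add: algebra_simps flip: right_diff_distrib)
    then show ?thesis
      unfolding has_real_derivative_iff_has_vector_derivative[symmetric]
      by (auto intro!: derivative_eq_intros simp: algebra_simps)
  qed
  from fundamental_theorem_of_calculus[OF pi_ge_zero this]
  have "(?f has_integral 0) {0..pi}" by (simp add: sin_npi_int mult.commute[of _ pi])
  moreover have "(?f has_integral (of_int k * weight_moment t k -
      t / 2 * (weight_moment t (k - 1) - weight_moment t (k + 1)))) {0..pi}"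
    unfolding weight_moment_def
    by (intro has_integral_diff has_integral_mult_right integrable_integral weight_moment_integrable)
  ultimately have "of_int k * weight_moment t k -
      t / 2 * (weight_moment t (k - 1) - weight_moment t (k + 1)) = 0"
    by (rule has_integral_unique[rotated])
  then show ?thesis by simp
qed

text \<open>The form is the integral of \<open>exp (t cos x) |p(e^(ix))|^2\<close> over
  \<open>[0, pi]\<close>; if it were 0, \<open>p\<close> would have infinitely many roots on the
  unit circle.\<close>

lemma weight_moment_toep_form_pos:
  assumes "p \<noteq> 0"
  shows "0 < toep_form (weight_moment t) p p"
proof -
  let ?q = "map_poly complex_of_real p" and ?I = "{..degree p}"
  define f where "f x = exp (t * cos x) * (cmod (poly ?q (cis x)))\<^sup>2" for x
  have f_eq: "f x = (\<Sum>j\<in>?I. \<Sum>i\<in>?I. coeff p j * coeff p i *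
      (exp (t * cos x) * cos (of_int (int i - int j) * x)))" for x
  proof -
    have q: "poly ?q (cis x) = (\<Sum>i\<in>?I. of_real (coeff p i) * cis (real i * x))"
      by (simp add: poly_altdef degree_map_poly coeff_map_poly Complex.DeMoivre)
    have "(cmod (poly ?q (cis x)))\<^sup>2 =
        (\<Sum>i\<in>?I. coeff p i * cos (real i * x))\<^sup>2 + (\<Sum>i\<in>?I. coeff p i * sin (real i * x))\<^sup>2"
      unfolding q by (simp add: cmod_power2)
    also have "\<dots> = (\<Sum>j\<in>?I. \<Sum>i\<in>?I. coeff p j * coeff p i * cos (of_int (int i - int j) * x))"
      by (simp add: power2_eq_square sum_product sum.distrib[symmetric] left_diff_distrib cos_diff algebra_simps)
    finally show ?thesis
      by (simp add: f_def sum_distrib_left mult_ac)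
  qed
  have "(f has_integral toep_form (weight_moment t) p p) {0..pi}"
    unfolding f_eq toep_form_double_sum[OF order_refl order_refl] weight_moment_def
    by (intro has_integral_sum has_integral_mult_right integrable_integral weight_moment_integrable) auto
  then have int: "integral {0..pi} f = toep_form (weight_moment t) p p"
    by (rule integral_unique)
  have nonneg: "0 \<le> f x" for x by (simp add: f_def)
  have cont: "continuous_on {0..pi} f"
    unfolding f_eq by (intro continuous_intros)
  have "integral {0..pi} f \<noteq> 0"
  proof
    assume "integral {0..pi} f = 0"
    then have "\<forall>x\<in>{0..pi}. f x = 0"
      using integral_eq_0_iff[OF cont] nonneg by simp
    then have "cis ` {0..pi} \<subseteq> {z. poly ?q z = 0}"
      by (auto simp: f_def)
    moreover have "?q \<noteq> 0"
      using assms by (simp add: map_poly_eq_0_iff)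
    ultimately have "finite (cis ` {0..pi})"
      using poly_roots_finite finite_subset by blast
    moreover have "inj_on cis {0..pi}"
      by (rule inj_onI) (auto simp: complex_eq_iff intro: cos_inj_pi)
    ultimately have "finite {0..pi}"
      using finite_imageD by blast
    then show False by (simp add: infinite_Icc)
  qed
  then show ?thesis
    using int integral_nonneg[OF integrable_continuous_interval[OF cont]] nonneg by force
qed

lemma toep_form_divide: "toep_form (\<lambda>k. m k / c) p q = toep_form m p q / c"
  by (simp add: toep_form_def toep_def sum_divide_distrib sum_distrib_left)

lemma weight_moment_0_pos: "0 < weight_moment t 0"
  using weight_moment_toep_form_pos[of 1 t] by (simp add: toep_form_def toep_1)

lemma bessel_moments_weight: "bessel_moments (\<lambda>k. weight_moment t k / weight_moment t 0) t"
proof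
  show "weight_moment t 0 / weight_moment t 0 = 1"
    using weight_moment_0_pos[of t] by simp
  show "of_int k * (weight_moment t k / weight_moment t 0) =
    t / 2 * (weight_moment t (k - 1) / weight_moment t 0 - weight_moment t (k + 1) / weight_moment t 0)" for k
    unfolding times_divide_eq_right weight_moment_pearson by (simp add: right_diff_distrib diff_divide_distrib)
qed (simp add: weight_moment_def)

lemma weight_toep_form_pos:
  "p \<noteq> 0 \<Longrightarrow> 0 < toep_form (\<lambda>k. weight_moment t k / weight_moment t 0) p p"
  using weight_moment_toep_form_pos weight_moment_0_pos by (simp add: toep_form_divide)

lemma bessel_ratio: "bessel_I 1 t / bessel_I 0 t = weight_moment t 1 / weight_moment t 0"
  by (simp add: bessel_I_eq_weight_moment)

section \<open>Solutions of discrete Painleve II\<close>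

lemma dPII_shift:
  assumes "dPII t a" "a (-1) = -1"
  defines "\<alpha> \<equiv> \<lambda>n. a (int n - 1)"
  shows "\<alpha> 0 = -1" "\<alpha> 1 = a 0"
    "\<alpha> (Suc (Suc n)) + \<alpha> n = - 2 * (real n + 1) * \<alpha> (Suc n) / (t * (1 - (\<alpha> (Suc n))\<^sup>2))"
  using assms(1)[unfolded dPII_def, rule_format, of "int n"] assms(2)
  by (simp_all add: \<alpha>_def algebra_simps)

lemma dPII_bounded_iff:
  assumes t: "t \<noteq> 0" and a: "dPII t a" "a (-1) = -1"
  shows "(\<forall>n\<ge>0. -1 < a n \<and> a n < 1) \<longleftrightarrow> a 0 = bessel_I 1 t / bessel_I 0 t"
proof -
  let ?w = "\<lambda>k. weight_moment t k / weight_moment t 0"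
  interpret W: bessel_moments ?w t by (rule bessel_moments_weight)
  define \<alpha> where "\<alpha> n = a (int n - 1)" for n
  note \<alpha> = dPII_shift[OF a, folded \<alpha>_def]
  have bounded_iff: "(\<forall>n\<ge>0. -1 < a n \<and> a n < 1) \<longleftrightarrow> (\<forall>n. (\<alpha> (Suc n))\<^sup>2 < 1)"
    unfolding \<alpha>_def abs_square_less_1 by (auto simp: abs_less_iff) (metis nonneg_int_cases minus_less_iff)+
  show ?thesis
  proof
    assume "a 0 = bessel_I 1 t / bessel_I 0 t"
    then show "\<forall>n\<ge>0. -1 < a n \<and> a n < 1"
      unfolding bounded_iff
      using W.verblunsky_less_1[OF t \<alpha>(1) _ \<alpha>(3)] \<alpha>(2) weight_toep_form_pos bessel_ratio by metis
  next
    assume "\<forall>n\<ge>0. -1 < a n \<and> a n < 1"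
    then have less_1: "(\<alpha> (Suc n))\<^sup>2 < 1" for n
      unfolding bounded_iff by blast
    \<comment> \<open>These formal moments have first moment \<open>a 0\<close>, so their Verblunsky
      coefficients are the given solution; it remains to identify them with \<open>?w\<close> at
      1.\<close>
    let ?m = "\<lambda>k. recurrence_moment t (a 0) (nat \<bar>k\<bar>)"
    interpret M: bessel_moments ?m t
      by (rule bessel_moments_recurrence_moment[OF t])
    have "\<bar>?m k\<bar> \<le> 1" for k
      by (rule M.abs_moment_le_1[OF t \<alpha>(1) _ \<alpha>(3) less_1]) (simp add: \<alpha>(2)[unfolded One_nat_def])
    moreover have "\<bar>?w k\<bar> \<le> 1" for k
    proof -
      have "0 \<le> toep_form ?w p p" for p
        using weight_toep_form_pos[of p t] by (cases "p = 0") (auto simp: toep_form_def)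
      then show ?thesis using W.abs_moment_le[of k] W.m0 by simp
    qed
    ultimately have "?m 1 = ?w 1"
      using bounded_bessel_moments_unique[OF M.bessel_moments_axioms W.bessel_moments_axioms t] by blast
    then show "a 0 = bessel_I 1 t / bessel_I 0 t"
      unfolding bessel_ratio by simp
  qed
qed

text \<open>Index 0 stands for -1. A vanishing denominator would yield a value unrelated to
  \<open>dPII\<close>; \<open>verblunsky_less_1\<close> excludes this for the Bessel ratio.\<close>

fun dPII_seq :: "real \<Rightarrow> real \<Rightarrow> nat \<Rightarrow> real" where
  "dPII_seq t c 0 = -1"
| "dPII_seq t c (Suc 0) = c"
| "dPII_seq t c (Suc (Suc n)) =
    - 2 * (real n + 1) * dPII_seq t c (Suc n) / (t * (1 - (dPII_seq t c (Suc n))\<^sup>2)) - dPII_seq t c n"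

lemma dPII_unique:
  assumes "dPII t a" "dPII t b" "a (-1) = b (-1)" "a 0 = b 0" "n \<ge> -1"
  shows "a n = b n"
proof -
  have "a (int k - 1) = b (int k - 1) \<and> a (int k) = b (int k)" for k
  proof (induction k)
    case 0
    then show ?case using assms by simp
  next
    case (Suc k)
    have "a (int k + 1) + a (int k - 1) = b (int k + 1) + b (int k - 1)"
      using assms(1,2)[unfolded dPII_def, rule_format, of "int k"] Suc by simp
    then show ?case using Suc by (simp add: add.commute)
  qed
  from this[of "nat (n + 1)"] show ?thesis using assms(5) by simp
qed

lemma dPII_bounded_exists:
  assumes t: "t \<noteq> 0"
  shows "\<exists>a. a \<in> extensional {-1..} \<and> a (-1) = -1 \<and> dPII t a \<and> a 0 = bessel_I 1 t / bessel_I 0 t"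
proof -
  interpret W: bessel_moments "\<lambda>k. weight_moment t k / weight_moment t 0" t
    by (rule bessel_moments_weight)
  define \<alpha> where "\<alpha> = dPII_seq t (bessel_I 1 t / bessel_I 0 t)"
  \<comment> \<open>The bound uses only the recursion, so it is available before \<open>dPII\<close>
    is established and supplies the nonzero denominators for it.\<close>
  have less_1: "(\<alpha> (Suc n))\<^sup>2 < 1" for n
    by (rule W.verblunsky_less_1[OF t]) (simp_all add: \<alpha>_def bessel_ratio[unfolded One_nat_def] weight_toep_form_pos)
  define a where "a = restrict (\<lambda>n. \<alpha> (nat (n + 1))) {-1..}"
  have "dPII t a"
    unfolding dPII_def
  proof (intro allI impI)
    fix n :: int assume "n \<ge> 0"
    then obtain k where k: "n = int k" by (metis nonneg_int_cases)
    have "nat (int k + 1 + 1) = Suc (Suc k)" "nat (int k + 1) = Suc k" by auto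
    then have "a n = \<alpha> (Suc k)" "a (n + 1) = \<alpha> (Suc (Suc k))" "a (n - 1) = \<alpha> k"
      by (simp_all add: a_def k)
    then show "(a n)\<^sup>2 \<noteq> 1 \<and> a (n + 1) + a (n - 1) = - 2 * (real_of_int n + 1) * a n / (t * (1 - (a n)\<^sup>2))"
      using less_1[of k] by (simp add: k \<alpha>_def)
  qed
  moreover have "a (-1) = -1" "a 0 = bessel_I 1 t / bessel_I 0 t" "a \<in> extensional {-1..}"
    by (simp_all add: a_def \<alpha>_def)
  ultimately show ?thesis by blast
qed

theorem theorem1:
  fixes t :: real
  assumes "t \<noteq> 0"
  shows "(\<exists>!a. a \<in> extensional {-1..} \<and> a (-1) = -1 \<and> (\<forall>n\<ge>0. -1 < a n \<and> a n < 1) \<and> dPII t a) \<and>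
    (\<forall>a. a \<in> extensional {-1..} \<and> a (-1) = -1 \<and> dPII t a \<longrightarrow>
      ((\<forall>n\<ge>0. -1 < a n \<and> a n < 1) \<longleftrightarrow> a 0 = bessel_I 1 t / bessel_I 0 t))"
proof (intro conjI allI impI)
  obtain a where a: "a \<in> extensional {-1..}" "a (-1) = -1" "dPII t a"
      "a 0 = bessel_I 1 t / bessel_I 0 t"
    using dPII_bounded_exists[OF assms] by blast
  show "\<exists>!a. a \<in> extensional {-1..} \<and> a (-1) = -1 \<and> (\<forall>n\<ge>0. -1 < a n \<and> a n < 1) \<and> dPII t a"
  proof (rule ex1I[of _ a])
    show "a \<in> extensional {-1..} \<and> a (-1) = -1 \<and> (\<forall>n\<ge>0. -1 < a n \<and> a n < 1) \<and> dPII t a"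
      using a dPII_bounded_iff[OF assms] by blast
  next
    fix b assume b: "b \<in> extensional {-1..} \<and> b (-1) = -1 \<and> (\<forall>n\<ge>0. -1 < b n \<and> b n < 1) \<and> dPII t b"
    then have "b 0 = a 0"
      using a dPII_bounded_iff[OF assms] by metis
    then show "b = a"
      using a b dPII_unique[of t b a] by (intro extensionalityI[of _ "{-1..}"]) auto
  qed
next
  fix a assume "a \<in> extensional {-1..} \<and> a (-1) = -1 \<and> dPII t a"
  then show "(\<forall>n\<ge>0. -1 < a n \<and> a n < 1) \<longleftrightarrow> a 0 = bessel_I 1 t / bessel_I 0 t"
    using dPII_bounded_iff[OF assms] by blast
qed

end
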